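(* Let $\alpha\in(0,1)$, $r>0$, $T>0$, let $d\ge 1$ be an integer, and let $\phi\in C([-r,0];\mathbb{R}^d)$. Assume that $f:[0,T]\times\mathbb{R}^d\times\mathbb{R}^d\to\mathbb{R}^d$ is continuous and that there exists a non-negative continuous function $L:[0,T]\times\mathbb{R}^d\to\mathbb{R}_{\ge 0}$ such that $$\|f(t,x,y)-f(t,\hat x,y)\|\le L(t,y)\,\|x-\hat x\|\qquad\text{for all } t\in[0,T],\ x,\hat x,y\in\mathbb{R}^d .$$ Then the delay Caputo fractional initial condition problem $$\,^{C}D^{\alpha}_{0+}x(t)=f(t,x(t),x(t-r)),\quad t\in[0,T],\qquad x(t)=\phi(t),\quad t\in[-r,0],$$ has a unique global solution $\varphi(\cdot,\phi)$ on the interval $[-r,T]$.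
   Context: $\mathbb{R}^d$ is equipped with a norm $\|\cdot\|$; $C([a,b];\mathbb{R}^d)$ is the space of continuous functions $[a,b]\to\mathbb{R}^d$. For $\alpha\in(0,1)$, $^{C}D^{\alpha}_{0+}$ denotes the Caputo fractional derivative of order $\alpha$ with base point $0$, applied componentwise: $(^{C}D^{\alpha}_{0+}x)(t)=\frac{1}{\Gamma(1-\alpha)}\int_0^t (t-\tau)^{-\alpha}x'(\tau)\,d\tau$ for absolutely continuous $x$. A solution of the initial condition problem on $[-r,T]$ is a function $\varphi\in C([-r,T];\mathbb{R}^d)$ satisfying the fractional equation on $[0,T]$ and $\varphi=\phi$ on $[-r,0]$. This is understood in the sense of the equivalent Volterra integral equation: $\varphi\in C([-r,T];\mathbb{R}^d)$ is a solution if and only if $\varphi(t)=\phi(t)$ for all $t\in[-r,0]$ and $$\varphi(t)=\phi(0)+\frac{1}{\Gamma(\alpha)}\int_0^t (t-\tau)^{\alpha-1}f(\tau,\varphi(\tau),\varphi(\tau-r))\,d\tau\quad\text{for all } t\in[0,T].$$ *)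

theory Defs
  imports "HOL-Analysis.Analysis"
begin

(* An arbitrary norm on a real vector space. It is kept separate from the Euclidean norm
   of the type real ^ 'd, which supplies the topology; in finite dimension every norm
   induces that same topology, so continuity may be stated with the library notion. *)
definition is_norm :: "('a::real_vector \<Rightarrow> real) \<Rightarrow> bool" where
  "is_norm N \<longleftrightarrow>
     (\<forall>x. 0 \<le> N x) \<and>
     (\<forall>x. N x = 0 \<longleftrightarrow> x = 0) \<and>
     (\<forall>c x. N (c *\<^sub>R x) = \<bar>c\<bar> * N x) \<and>
     (\<forall>x y. N (x + y) \<le> N x + N y)"

(* Riemann-Liouville fractional integral of order a with base point 0. The kernel
   (t - s) powr (a - 1) takes the value 0 at s = t; this null set is irrelevant. For g
   continuous on {0..t} and 0 < a the integrand is absolutely integrable, so the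
   Henstock-Kurzweil integral used here is the Lebesgue integral. *)
definition frac_integral :: "real \<Rightarrow> (real \<Rightarrow> 'a::euclidean_space) \<Rightarrow> real \<Rightarrow> 'a" where
  "frac_integral a g t =
     (1 / Gamma a) *\<^sub>R integral {0..t} (\<lambda>s. (t - s) powr (a - 1) *\<^sub>R g s)"

(* Solution on {-r..T} of the problem
     (Caputo derivative of order a of x)(t) = f t (x t) (x (t - r))  on {0..T},
     x = phi  on {-r..0},
   understood in the sense of its Volterra integral equation. Only the values of x on
   {-r..T} are constrained. *)
definition caputo_delay_solution ::
  "real \<Rightarrow> real \<Rightarrow> real \<Rightarrow>
   (real \<Rightarrow> 'a \<Rightarrow> 'a \<Rightarrow> 'a) \<Rightarrow> (real \<Rightarrow> 'a) \<Rightarrow> (real \<Rightarrow> 'a::euclidean_space) \<Rightarrow> bool" where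
  "caputo_delay_solution a r T f \<phi> x \<longleftrightarrow>
     continuous_on {-r..T} x \<and>
     (\<forall>t\<in>{-r..0}. x t = \<phi> t) \<and>
     (\<forall>t\<in>{0..T}. x t = \<phi> 0 + frac_integral a (\<lambda>s. f s (x s) (x (s - r))) t)"

end

(* On a single delay interval the delayed argument x (t - r) is already known, so the problem is a
   weakly singular Volterra equation without delay whose right-hand side is Lipschitz in x, with
   constant the maximum of L (t, x (t - r)) over the compact interval. Such an equation has exactly
   one continuous solution by the Banach fixed point theorem in a Bielecki-weighted supremum norm.
   Advancing by r at a time, the method of steps reaches T after finitely many intervals; since all
   norms on a Euclidean space are equivalent, the Lipschitz condition may be read in the Euclidean
   norm. *)

theory Submission
  imports Defs
begin

section \<open>Equivalence of norms in finite dimension\<close>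

text \<open>Expanding \<open>x\<close> in \<open>Basis\<close>, the triangle inequality and
  homogeneity bound \<open>N x\<close> by the sum of the \<open>N b\<close>, weighted by coordinates
  of size at most \<open>norm x\<close>.\<close>

lemma is_norm_le_norm:
  fixes N :: "'a::euclidean_space \<Rightarrow> real"
  assumes "is_norm N"
  obtains C where "C > 0" "\<And>x. N x \<le> C * norm x"
proof
  have tri: "N (x + y) \<le> N x + N y" and scale: "N (c *\<^sub>R x) = \<bar>c\<bar> * N x"
    and nonneg: "0 \<le> N x" and zero: "N 0 = 0" for x y c
    using assms unfolding is_norm_def by blast+
  have sum_le: "N (sum g A) \<le> (\<Sum>i\<in>A. N (g i))" if "finite A" for g and A :: "'a set"
    using that by (induction rule: finite_induct) (use zero in \<open>auto intro: order_trans[OF tri]\<close>)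
  \<comment> \<open>The summand 1 gives positivity at once, without exhibiting a basis vector with
    \<open>N b > 0\<close>.\<close>
  show "0 < 1 + (\<Sum>b\<in>Basis. N b)"
    using nonneg by (simp add: sum_nonneg add_pos_nonneg)
  show "N x \<le> (1 + (\<Sum>b\<in>Basis. N b)) * norm x" for x
  proof -
    have "N x = N (\<Sum>b\<in>Basis. (x \<bullet> b) *\<^sub>R b)"
      by (simp add: euclidean_representation)
    also have "\<dots> \<le> (\<Sum>b\<in>Basis. N ((x \<bullet> b) *\<^sub>R b))"
      by (rule sum_le) simp
    also have "\<dots> \<le> (\<Sum>b\<in>Basis. norm x * N b)"
      using nonneg by (intro sum_mono) (auto simp: scale Basis_le_norm intro: mult_right_mono)
    also have "\<dots> = norm x * (\<Sum>b\<in>Basis. N b)"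
      by (rule sum_distrib_left[symmetric])
    also have "\<dots> \<le> (1 + (\<Sum>b\<in>Basis. N b)) * norm x"
      by (simp add: distrib_left mult.commute)
    finally show ?thesis .
  qed
qed

text \<open>By the opposite bound \<open>N\<close> is Lipschitz, so it attains its minimum on the
  compact Euclidean unit sphere. This minimum is positive, and homogeneity carries the resulting
  bound to all vectors.\<close>

lemma norm_le_is_norm:
  fixes N :: "'a::euclidean_space \<Rightarrow> real"
  assumes "is_norm N"
  obtains C where "C > 0" "\<And>x. norm x \<le> C * N x"
proof -
  have tri: "N (x + y) \<le> N x + N y" and scale: "N (c *\<^sub>R x) = \<bar>c\<bar> * N x"
    and nonneg: "0 \<le> N x" and zero: "N x = 0 \<longleftrightarrow> x = 0" for x y c
    using assms unfolding is_norm_def by blast+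
  obtain B where B: "B > 0" "\<And>x. N x \<le> B * norm x"
    using is_norm_le_norm[OF assms] by blast
  have "dist (N x) (N y) \<le> B * dist x y" for x y
  proof -
    have "N (y - x) = N (x - y)"
      using scale[of "-1" "x - y"] by simp
    then show ?thesis
      using tri[of "x - y" y] tri[of "y - x" x] B(2)[of "x - y"]
      by (auto simp: dist_real_def dist_norm)
  qed
  then have "B-lipschitz_on UNIV N"
    using B(1) by (intro lipschitz_onI) auto
  then have cont: "continuous_on (sphere 0 1) N"
    using lipschitz_on_continuous_on continuous_on_subset by blast
  have "sphere (0::'a) 1 \<noteq> {}"
    by simp
  then obtain u where u: "u \<in> sphere 0 1" "\<And>v. v \<in> sphere 0 1 \<Longrightarrow> N u \<le> N v"
    using continuous_attains_inf[OF compact_sphere _ cont] by blast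
  have "u \<noteq> 0"
    using u(1) by force
  then have pos: "N u > 0"
    using nonneg[of u] zero[of u] by linarith
  have "norm x \<le> (1 / N u) * N x" for x
  proof (cases "x = 0")
    case False
    then have "N u \<le> N (inverse (norm x) *\<^sub>R x)"
      by (intro u(2)) (simp add: field_simps)
    also have "\<dots> = inverse (norm x) * N x"
      by (simp add: scale)
    finally show ?thesis
      using False pos by (simp add: field_simps)
  qed (use nonneg pos in simp)
  with pos show ?thesis
    by (intro that[of "1 / N u"]) auto
qed

section \<open>Affine substitutions in integrals\<close>

text \<open>The substitution \<open>u = m * (t - s)\<close>. With \<open>m = 1\<close> it moves the
  singularity of the kernel to 0; with \<open>m = k\<close> it produces the Gamma integrand.\<close>

lemma has_integral_reflect_scale:
  fixes h :: "real \<Rightarrow> 'a::euclidean_space"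
  assumes "(h has_integral I) {0..m * t}" "m > 0"
  shows "((\<lambda>s. h (m * (t - s))) has_integral (I /\<^sub>R m)) {0..t}"
proof -
  \<comment> \<open>\<open>has_integral_affinity\<close> gives its domain as the image of the old
    interval under the inverse map; the slope is negative, so the endpoints swap.\<close>
  have "(\<lambda>x. (1 / (-m)) *\<^sub>R x + - ((1 / (-m)) *\<^sub>R (m * t))) ` cbox 0 (m * t) = {0..t}"
    (is "?g ` _ = _")
  proof -
    have "?g = (\<lambda>x. (- 1 / m) * x + t)"
      using assms(2) by auto
    moreover have "(\<lambda>x. (- 1 / m) * x + t) ` {0..m * t} = {0..t}"
      unfolding image_affinity_atLeastAtMost
      using assms(2) by (auto simp: zero_le_mult_iff mult_le_0_iff)
    ultimately show ?thesis
      unfolding box_real by (simp only:)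
  qed
  with has_integral_affinity[of h I 0 "m * t" "-m" "m * t"] assms
  show ?thesis
    by (auto simp: algebra_simps divide_inverse)
qed

lemma has_integral_scale:
  fixes h :: "real \<Rightarrow> 'a::euclidean_space"
  assumes "(h has_integral I) {0..1}" "t > 0"
  shows "((\<lambda>s. h (s / t)) has_integral (t *\<^sub>R I)) {0..t}"
proof -
  have "(\<lambda>x. (1 / (1 / t)) *\<^sub>R x + - ((1 / (1 / t)) *\<^sub>R 0)) ` cbox 0 1 = {0..t}"
    (is "?g ` _ = _")
  proof -
    have "?g = (\<lambda>x. t * x + 0)"
      by auto
    then show ?thesis
      using assms(2) unfolding box_real image_affinity_atLeastAtMost
      by auto
  qed
  with has_integral_affinity[of h I 0 1 "1 / t" 0] assms
  show ?thesis
    by auto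
qed

section \<open>Integrability of the weakly singular kernel\<close>

text \<open>The kernel is non-negative with finite integral
  \<open>t powr \<alpha> / \<alpha>\<close>, and a bounded measurable factor preserves absolute
  integrability.\<close>

lemma frac_kernel_absolutely_integrable:
  fixes g :: "real \<Rightarrow> 'a::euclidean_space"
  assumes "0 < \<alpha>" "0 \<le> t" "continuous_on {0..t} g"
  shows "(\<lambda>s. (t - s) powr (\<alpha> - 1) *\<^sub>R g s) absolutely_integrable_on {0..t}"
proof -
  have "((\<lambda>s. s powr (\<alpha> - 1)) has_integral (t powr \<alpha> / \<alpha>)) {0..t}"
    using has_integral_powr_from_0[of "\<alpha> - 1" t] assms by simp
  then have "((\<lambda>s. (t - s) powr (\<alpha> - 1)) has_integral (t powr \<alpha> / \<alpha>)) {0..t}"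
    using has_integral_reflect_scale[of "\<lambda>s. s powr (\<alpha> - 1)" _ 1 t] by simp
  then have "(\<lambda>s. (t - s) powr (\<alpha> - 1)) absolutely_integrable_on {0..t}"
    by (intro nonnegative_absolutely_integrable_1) auto
  moreover have "g \<in> borel_measurable (lebesgue_on {0..t})"
    using assms(3) by (intro continuous_imp_measurable_on_sets_lebesgue) auto
  moreover have "bounded (g ` {0..t})"
    using assms(3) compact_continuous_image compact_imp_bounded by blast
  moreover have "bilinear (\<lambda>(x::'a) (c::real). c *\<^sub>R x)"
    by (auto simp: bilinear_def scaleR_add_left scaleR_add_right intro!: linearI)
  ultimately show ?thesis
    using absolutely_integrable_bounded_measurable_product
      [of "\<lambda>(x::'a) (c::real). c *\<^sub>R x" g "{0..t}" "\<lambda>s. (t - s) powr (\<alpha> - 1)"] by auto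
qed

lemma frac_kernel_integrable:
  fixes g :: "real \<Rightarrow> 'a::euclidean_space"
  assumes "0 < \<alpha>" "0 \<le> t" "continuous_on {0..t} g"
  shows "(\<lambda>s. (t - s) powr (\<alpha> - 1) *\<^sub>R g s) integrable_on {0..t}"
  using frac_kernel_absolutely_integrable[OF assms] set_lebesgue_integral_eq_integral(1) by blast

section \<open>Weighted bounds and continuity of the fractional integral\<close>

text \<open>Substituting \<open>u = k * (t - s)\<close> leaves
  \<open>exp (k * t) / k powr \<alpha>\<close> times the Gamma integral truncated at
  \<open>k * t\<close>, which is at most \<open>Gamma \<alpha>\<close> because its integrand is
  non-negative. The factor \<open>1 / k powr \<alpha>\<close> is the source of the
  contraction.\<close>

lemma frac_integral_exp_le:
  fixes \<alpha> k t :: real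
  assumes "0 < \<alpha>" "0 < k" "0 \<le> t"
  shows "integral {0..t} (\<lambda>s. (t - s) powr (\<alpha> - 1) * exp (k * s))
    \<le> Gamma \<alpha> * exp (k * t) / k powr \<alpha>"
proof -
  define h where "h u = u powr (\<alpha> - 1) / exp u" for u :: real
  have Gamma: "(h has_integral Gamma \<alpha>) {0..}"
    unfolding h_def using Gamma_integral_real[OF assms(1)] .
  then have "h integrable_on {0..k * t}"
    using integrable_on_subinterval[of h "{0..}" 0 "k * t"] by (auto simp: integrable_on_def)
  then obtain I where I: "(h has_integral I) {0..k * t}"
    by blast
  have "I \<le> Gamma \<alpha>"
    by (rule has_integral_subset_le[OF _ I Gamma]) (auto simp: h_def)
  have "((\<lambda>s. exp (k * t) * k powr (1 - \<alpha>) * h (k * (t - s)))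
      has_integral exp (k * t) * k powr (1 - \<alpha>) * (I / k)) {0..t}"
    using has_integral_reflect_scale[OF I assms(2)] assms(2)
    by (intro has_integral_mult_right) (simp add: divide_inverse mult.commute)
  then have "((\<lambda>s. (t - s) powr (\<alpha> - 1) * exp (k * s))
      has_integral exp (k * t) * k powr (1 - \<alpha>) * (I / k)) {0..t}"
  proof (rule has_integral_eq[rotated])
    fix s
    have "(k * (t - s)) powr (\<alpha> - 1) = k powr (\<alpha> - 1) * (t - s) powr (\<alpha> - 1)"
      by (rule powr_mult)
    moreover have "k powr (1 - \<alpha>) * k powr (\<alpha> - 1) = 1"
      using assms by (simp flip: powr_add)
    moreover have "exp (k * (t - s)) = exp (k * t) / exp (k * s)"
      by (simp add: right_diff_distrib exp_diff)
    ultimately show "exp (k * t) * k powr (1 - \<alpha>) * h (k * (t - s)) = (t - s) powr (\<alpha> - 1) * exp (k * s)"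
      by (simp add: h_def)
  qed
  then have "integral {0..t} (\<lambda>s. (t - s) powr (\<alpha> - 1) * exp (k * s))
      = exp (k * t) * k powr (1 - \<alpha>) * (I / k)"
    by (rule integral_unique)
  also have "\<dots> = I * exp (k * t) / k powr \<alpha>"
    using assms by (simp add: powr_diff field_simps)
  also have "\<dots> \<le> Gamma \<alpha> * exp (k * t) / k powr \<alpha>"
    using \<open>I \<le> Gamma \<alpha>\<close> by (intro divide_right_mono mult_right_mono) auto
  finally show ?thesis .
qed

text \<open>In the sup norm weighted by \<open>exp (- k * t)\<close>, the fractional integral has
  operator norm at most \<open>1 / k powr \<alpha>\<close>: the \<open>Gamma \<alpha>\<close> of the
  kernel bound cancels the normalising factor.\<close>

lemma frac_integral_diff_le:
  fixes g h :: "real \<Rightarrow> 'a::euclidean_space"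
  assumes "0 < \<alpha>" "0 < k" "0 \<le> t" "continuous_on {0..t} g" "continuous_on {0..t} h"
    and le: "\<And>s. s \<in> {0..t} \<Longrightarrow> norm (g s - h s) \<le> C * exp (k * s)" and "0 \<le> C"
  shows "norm (frac_integral \<alpha> g t - frac_integral \<alpha> h t) \<le> C * exp (k * t) / k powr \<alpha>"
proof -
  let ?K = "\<lambda>s. (t - s) powr (\<alpha> - 1)"
  have "integral {0..t} (\<lambda>s. ?K s *\<^sub>R g s) - integral {0..t} (\<lambda>s. ?K s *\<^sub>R h s)
      = integral {0..t} (\<lambda>s. ?K s *\<^sub>R (g s - h s))"
    using assms by (simp add: integral_diff frac_kernel_integrable scaleR_diff_right)
  \<comment> \<open>The majorant keeps the form kernel \<open>*\<^sub>R\<close> continuous function,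
    so \<open>frac_kernel_integrable\<close> covers it too.\<close>
  also have "norm \<dots> \<le> integral {0..t} (\<lambda>s. ?K s *\<^sub>R (C * exp (k * s)))"
    using assms
    by (intro integral_norm_bound_integral frac_kernel_integrable continuous_intros)
      (auto intro: mult_left_mono)
  also have "\<dots> = C * integral {0..t} (\<lambda>s. ?K s * exp (k * s))"
    by (simp add: mult.left_commute)
  also have "\<dots> \<le> C * (Gamma \<alpha> * exp (k * t) / k powr \<alpha>)"
    using assms by (intro mult_left_mono frac_integral_exp_le)
  finally have le_Gamma: "norm (integral {0..t} (\<lambda>s. ?K s *\<^sub>R g s) - integral {0..t} (\<lambda>s. ?K s *\<^sub>R h s))
      \<le> Gamma \<alpha> * (C * exp (k * t) / k powr \<alpha>)"
    by (simp add: mult_ac)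
  have "Gamma \<alpha> > 0"
    using assms(1) by (rule Gamma_real_pos)
  then have "norm (frac_integral \<alpha> g t - frac_integral \<alpha> h t)
      = norm (integral {0..t} (\<lambda>s. ?K s *\<^sub>R g s) - integral {0..t} (\<lambda>s. ?K s *\<^sub>R h s)) / Gamma \<alpha>"
    unfolding frac_integral_def scaleR_diff_right[symmetric] norm_scaleR by simp
  also have "\<dots> \<le> C * exp (k * t) / k powr \<alpha>"
    using le_Gamma \<open>Gamma \<alpha> > 0\<close> by (subst pos_divide_le_eq) (simp_all only: mult.commute)
  finally show ?thesis .
qed

text \<open>The substitution \<open>s = t * u\<close> moves the \<open>t\<close>-dependence out of the singular kernel.\<close>

lemma frac_integral_rescale:
  fixes g :: "real \<Rightarrow> 'a::euclidean_space"
  assumes "0 < \<alpha>" "0 \<le> t" "continuous_on {0..t} g"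
  shows "frac_integral \<alpha> g t
    = (t powr \<alpha> / Gamma \<alpha>) *\<^sub>R integral {0..1} (\<lambda>u. (1 - u) powr (\<alpha> - 1) *\<^sub>R g (t * u))"
proof (cases "t = 0")
  case True
  then show ?thesis
    by (simp add: frac_integral_def)
next
  case False
  with assms have "t > 0"
    by simp
  let ?I = "integral {0..1} (\<lambda>u. (1 - u) powr (\<alpha> - 1) *\<^sub>R g (t * u))"
  have "continuous_on {0..1} (\<lambda>u. g (t * u))"
    using \<open>t > 0\<close>
    by (intro continuous_on_compose2[OF assms(3)] continuous_intros) (auto simp: mult_left_le)
  then have "((\<lambda>u. (1 - u) powr (\<alpha> - 1) *\<^sub>R g (t * u)) has_integral ?I) {0..1}"
    using frac_kernel_integrable[of \<alpha> 1] assms(1) by (intro integrable_integral) auto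
  \<comment> \<open>The factor \<open>t powr (\<alpha> - 1)\<close> is absorbed by the kernel,
    turning \<open>1 - s / t\<close> into \<open>t - s\<close>; with the \<open>t\<close> from the
    scaling it yields \<open>t powr \<alpha>\<close>.\<close>
  from has_integral_cmul[OF has_integral_scale[OF this \<open>t > 0\<close>], of "t powr (\<alpha> - 1)"]
  have "((\<lambda>s. (t - s) powr (\<alpha> - 1) *\<^sub>R g s) has_integral (t powr (\<alpha> - 1) *\<^sub>R t *\<^sub>R ?I)) {0..t}"
  proof (rule has_integral_eq[rotated])
    fix s assume "s \<in> {0..t}"
    have "t powr (\<alpha> - 1) * (1 - s / t) powr (\<alpha> - 1) = (t * (1 - s / t)) powr (\<alpha> - 1)"
      using \<open>t > 0\<close> \<open>s \<in> _\<close> by (subst powr_mult) auto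
    also have "t * (1 - s / t) = t - s"
      using \<open>t > 0\<close> by (simp add: field_simps)
    finally show "t powr (\<alpha> - 1) *\<^sub>R (1 - s / t) powr (\<alpha> - 1) *\<^sub>R g (t * (s / t))
        = (t - s) powr (\<alpha> - 1) *\<^sub>R g s"
      using \<open>t > 0\<close> by simp
  qed
  then have "integral {0..t} (\<lambda>s. (t - s) powr (\<alpha> - 1) *\<^sub>R g s) = t powr \<alpha> *\<^sub>R ?I"
    using \<open>t > 0\<close> by (simp add: integral_unique powr_diff)
  then show ?thesis
    by (simp add: frac_integral_def)
qed

text \<open>After rescaling, both the domain and the kernel are independent of \<open>t\<close>, so
  dominated convergence along sequences applies, with the kernel times a bound of \<open>g\<close>
  as majorant.\<close>

lemma continuous_on_frac_integral:
  fixes g :: "real \<Rightarrow> 'a::euclidean_space"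
  assumes "0 < \<alpha>" and g: "continuous_on {0..T} g"
  shows "continuous_on {0..T} (frac_integral \<alpha> g)"
proof -
  let ?K = "\<lambda>u::real. (1 - u) powr (\<alpha> - 1)"
  let ?I = "\<lambda>t. integral {0..1} (\<lambda>u. ?K u *\<^sub>R g (t * u))"
  have "bounded (g ` {0..T})"
    using g compact_continuous_image compact_imp_bounded by blast
  then obtain B where B: "\<And>s. s \<in> {0..T} \<Longrightarrow> norm (g s) \<le> B"
    unfolding bounded_iff by blast
  have mem: "t * u \<in> {0..T}" if "t \<in> {0..T}" "u \<in> {0..1}" for t u
    using that mult_left_le[of u t] by auto
  have cont: "continuous_on {0..1} (\<lambda>u. g (t * u))" if "t \<in> {0..T}" for t
    using mem[OF that] by (intro continuous_on_compose2[OF g] continuous_intros) auto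
  have "continuous_on {0..T} ?I"
    unfolding continuous_on_sequentially comp_def
  proof (intro allI ballI impI, elim conjE)
    fix X t assume t: "t \<in> {0..T}" and X: "\<forall>n::nat. X n \<in> {0..T}" "X \<longlonglongrightarrow> t"
    show "(\<lambda>n. ?I (X n)) \<longlonglongrightarrow> ?I t"
    proof (rule dominated_convergence(2))
      show "(\<lambda>u. ?K u *\<^sub>R g (X n * u)) integrable_on {0..1}" for n
        using X cont assms(1) by (intro frac_kernel_integrable) auto
      show "(\<lambda>u. ?K u *\<^sub>R B) integrable_on {0..1}"
        using assms(1) by (intro frac_kernel_integrable) auto
      show "norm (?K u *\<^sub>R g (X n * u)) \<le> ?K u *\<^sub>R B" if "u \<in> {0..1}" for n u
        using B[OF mem[OF _ that]] X by (auto intro: mult_left_mono)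
      show "(\<lambda>n. ?K u *\<^sub>R g (X n * u)) \<longlonglongrightarrow> ?K u *\<^sub>R g (t * u)" if "u \<in> {0..1}" for u
        using X t mem[OF _ that]
        by (intro tendsto_intros continuous_on_tendsto_compose[OF g]) auto
    qed
  qed
  \<comment> \<open>Continuity at the endpoint 0 relies on the exponent being positive.\<close>
  moreover have "continuous_on {0..T} (\<lambda>t. t powr \<alpha>)"
    using assms(1) by (intro continuous_on_powr') (auto intro: continuous_intros)
  ultimately have "continuous_on {0..T} (\<lambda>t. (t powr \<alpha> / Gamma \<alpha>) *\<^sub>R ?I t)"
    using Gamma_real_pos[OF assms(1)]
    by (intro continuous_on_scaleR continuous_on_divide continuous_on_const) auto
  then show ?thesis
    using assms(1) continuous_on_subset[OF g]
    by (subst continuous_on_cong[OF refl frac_integral_rescale]) auto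
qed

lemma frac_integral_cong:
  assumes "\<And>s. s \<in> {0..t} \<Longrightarrow> g s = h s"
  shows "frac_integral \<alpha> g t = frac_integral \<alpha> h t"
  using assms unfolding frac_integral_def by (auto intro!: arg_cong2[where f=scaleR] integral_cong)


section \<open>The Volterra equation without delay\<close>

lemma continuous_on_apply_path:
  assumes "continuous_on (I \<times> UNIV) (\<lambda>(t, x). G t x)" "continuous_on J v" "J \<subseteq> I"
  shows "continuous_on J (\<lambda>s. G s (v s))"
proof -
  have "continuous_on J (\<lambda>s. (\<lambda>(t, x). G t x) (s, v s))"
    using assms by (intro continuous_on_compose2[OF assms(1)] continuous_intros) auto
  then show ?thesis
    by simp
qed

text \<open>With the Bielecki weight \<open>exp (- k * t)\<close> the Volterra operator has Lipschitz constant
  \<open>M / k powr \<alpha>\<close>, so it is a contraction on the whole interval once \<open>k\<close> is large.\<close>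

lemma frac_volterra_unique_solution:
  fixes G :: "real \<Rightarrow> 'a::euclidean_space \<Rightarrow> 'a"
  assumes "0 < \<alpha>" "0 \<le> S"
    and G: "continuous_on ({0..S} \<times> UNIV) (\<lambda>(t, x). G t x)"
    and Lip: "\<And>t x y. t \<in> {0..S} \<Longrightarrow> norm (G t x - G t y) \<le> M * norm (x - y)"
  obtains x where "continuous_on {0..S} x"
    "\<And>t. t \<in> {0..S} \<Longrightarrow> x t = c + frac_integral \<alpha> (\<lambda>s. G s (x s)) t"
    "\<And>z t. \<lbrakk>continuous_on {0..S} z; \<And>t. t \<in> {0..S} \<Longrightarrow> z t = c + frac_integral \<alpha> (\<lambda>s. G s (z s)) t;
      t \<in> {0..S}\<rbrakk> \<Longrightarrow> z t = x t"
proof -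
  \<comment> \<open>Chosen so that \<open>\<bar>M\<bar> / k powr \<alpha>\<close> is at most 1/2;
    the added 1 keeps \<open>k\<close> positive when \<open>M = 0\<close>.\<close>
  define k where "k = (2 * (\<bar>M\<bar> + 1)) powr (1 / \<alpha>)"
  have k: "0 < k" "k powr \<alpha> = 2 * (\<bar>M\<bar> + 1)"
    using assms(1) by (auto simp: k_def powr_powr)
  \<comment> \<open>The Volterra operator conjugated by the weight: \<open>v\<close> stands for
    \<open>exp (- k * t) *\<^sub>R x t\<close>, so the Bielecki norm of \<open>x\<close> becomes the
    plain sup norm of \<open>v\<close>.\<close>
  define F where "F v t = exp (- k * t) *\<^sub>R (c + frac_integral \<alpha> (\<lambda>s. G s (exp (k * s) *\<^sub>R v s)) t)"
    for v t
  have contG: "continuous_on {0..t} (\<lambda>s. G s (exp (k * s) *\<^sub>R v s))"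
    if "continuous_on {0..S} v" "t \<le> S" for v t
    using that by (intro continuous_on_apply_path[OF G] continuous_intros)
      (auto intro: continuous_on_subset)
  have contF: "continuous_on {0..S} (F v)" if "continuous_on {0..S} v" for v
    unfolding F_def using assms(1) contG[OF that]
    by (intro continuous_intros continuous_on_frac_integral) auto
  have contr: "norm (F u t - F v t) \<le> 1 / 2 * D"
    if u: "continuous_on {0..S} u" and v: "continuous_on {0..S} v"
      and D: "\<And>s. s \<in> {0..S} \<Longrightarrow> norm (u s - v s) \<le> D" and t: "t \<in> {0..S}" for u v D t
  proof -
    have "0 \<le> D"
      using D[OF t] norm_ge_zero order_trans by blast
    let ?g = "\<lambda>v s. G s (exp (k * s) *\<^sub>R v s)"
    have "norm (frac_integral \<alpha> (?g u) t - frac_integral \<alpha> (?g v) t)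
        \<le> (\<bar>M\<bar> * D) * exp (k * t) / k powr \<alpha>"
    proof (rule frac_integral_diff_le)
      fix s assume "s \<in> {0..t}"
      then have s: "s \<in> {0..S}"
        using t by auto
      have "norm (?g u s - ?g v s) \<le> M * norm (exp (k * s) *\<^sub>R (u s - v s))"
        using Lip[OF s] by (simp add: scaleR_diff_right)
      also have "\<dots> = M * norm (u s - v s) * exp (k * s)"
        by simp
      also have "\<dots> \<le> \<bar>M\<bar> * D * exp (k * s)"
        using D[OF s] by (intro mult_right_mono mult_mono) auto
      finally show "norm (?g u s - ?g v s) \<le> \<bar>M\<bar> * D * exp (k * s)" .
    qed (use assms(1) k t contG u v \<open>0 \<le> D\<close> in auto)
    then have "exp (- k * t) * norm (frac_integral \<alpha> (?g u) t - frac_integral \<alpha> (?g v) t)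
        \<le> exp (- k * t) * ((\<bar>M\<bar> * D) * exp (k * t) / k powr \<alpha>)"
      by (intro mult_left_mono) auto
    also have "\<dots> = \<bar>M\<bar> / (2 * (\<bar>M\<bar> + 1)) * D"
      using k by (simp add: exp_minus)
    also have "\<dots> \<le> 1 / 2 * D"
      using \<open>0 \<le> D\<close> by (intro mult_right_mono) (auto simp: field_simps)
    finally show ?thesis
      by (simp add: F_def flip: scaleR_diff_right)
  qed
  \<comment> \<open>Clamping extends a continuous function on \<open>{0..S}\<close> to a bounded
    continuous one on the whole line, constant outside. The operator thus acts on the complete space
    of bounded continuous functions.\<close>
  have clamp: "clamp 0 S t \<in> {0..S}" for t
    using clamp_in_interval[of 0 S t] assms(2) by simp
  have clamp_id: "clamp 0 S t = t" if "t \<in> {0..S}" for t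
    using clamp_cancel_cbox[of t 0 S] that by simp
  have "\<exists>w :: real \<Rightarrow>\<^sub>C 'a. \<forall>t. w t = F v (clamp 0 S t)" for v :: "real \<Rightarrow>\<^sub>C 'a"
  proof -
    have "continuous_on (cbox 0 S) (F v)"
      using contF by simp
    from continuous_on_cbox_bcontfunE[OF this] show ?thesis
      by metis
  qed
  then obtain \<Phi> :: "(real \<Rightarrow>\<^sub>C 'a) \<Rightarrow> (real \<Rightarrow>\<^sub>C 'a)"
    where \<Phi>: "\<And>v t. \<Phi> v t = F v (clamp 0 S t)"
    by metis
  have "dist (\<Phi> u) (\<Phi> v) \<le> 1 / 2 * dist u v" for u v
  proof (rule dist_bound)
    show "dist (\<Phi> u t) (\<Phi> v t) \<le> 1 / 2 * dist u v" for t
      unfolding \<Phi> dist_norm[of "F u _"]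
      using dist_bounded[of u _ v] by (intro contr clamp) (auto simp: dist_norm)
  qed
  then have "\<exists>!w. \<Phi> w = w"
    by (intro banach_fix_type[of "1 / 2"]) auto
  then obtain w where w: "\<Phi> w = w" and w_unique: "\<And>v. \<Phi> v = v \<Longrightarrow> v = w"
    by metis
  define x where "x t = exp (k * t) *\<^sub>R w t" for t
  show thesis
  proof
    show "continuous_on {0..S} x"
      unfolding x_def by (intro continuous_intros) auto
    show "x t = c + frac_integral \<alpha> (\<lambda>s. G s (x s)) t" if "t \<in> {0..S}" for t
    proof -
      have "w t = F w t"
        using \<Phi>[of w t] w clamp_id[OF that] by simp
      then show ?thesis
        by (simp add: x_def F_def exp_minus)
    qed
    show "z t = x t"
      if z: "continuous_on {0..S} z"
        and sol: "\<And>t. t \<in> {0..S} \<Longrightarrow> z t = c + frac_integral \<alpha> (\<lambda>s. G s (z s)) t"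
        and t: "t \<in> {0..S}" for z t
    proof -
      \<comment> \<open>A competing solution, weighted and extended by clamping, is a fixed point on
        the whole line and hence equals \<open>w\<close>.\<close>
      have "continuous_on (cbox 0 S) (\<lambda>t. exp (- k * t) *\<^sub>R z t)"
        using z by (intro continuous_intros) auto
      then obtain v :: "real \<Rightarrow>\<^sub>C 'a"
        where v: "\<And>t. v t = exp (- k * clamp 0 S t) *\<^sub>R z (clamp 0 S t)"
        by (rule continuous_on_cbox_bcontfunE) blast
      have zv: "exp (k * s) *\<^sub>R v s = z s" if "s \<in> {0..S}" for s
        using v[of s] clamp_id[OF that] by (simp add: exp_minus)
      have "\<Phi> v s = v s" for s
      proof -
        let ?s = "clamp 0 S s"
        have "frac_integral \<alpha> (\<lambda>s. G s (exp (k * s) *\<^sub>R v s)) ?s = frac_integral \<alpha> (\<lambda>s. G s (z s)) ?s"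
          using zv clamp[of s] by (intro frac_integral_cong) auto
        then show ?thesis
          unfolding \<Phi> F_def v[of s] using sol[OF clamp, of s] by simp
      qed
      then have "v = w"
        by (intro w_unique bcontfun_eqI)
      then show ?thesis
        using zv[OF t] by (simp add: x_def)
    qed
  qed
qed

section \<open>Extension of solutions by at most one delay\<close>

lemma caputo_delay_solution_continuous_on:
  assumes "caputo_delay_solution \<alpha> r T f \<phi> x"
  shows "continuous_on {-r..T} x"
  using assms unfolding caputo_delay_solution_def by blast

lemma caputo_delay_solution_history:
  assumes "caputo_delay_solution \<alpha> r T f \<phi> x" "t \<in> {-r..0}"
  shows "x t = \<phi> t"
  using assms unfolding caputo_delay_solution_def by blast

lemma caputo_delay_solution_subinterval:
  assumes "caputo_delay_solution \<alpha> r S' f \<phi> x" "S \<le> S'"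
  shows "caputo_delay_solution \<alpha> r S f \<phi> x"
  using assms unfolding caputo_delay_solution_def by (auto intro: continuous_on_subset)

text \<open>For \<open>s \<le> S'\<close> the time \<open>s - r\<close> is at most \<open>S\<close>,
  so the delayed value is known from \<open>x\<close>. The fractional integral remembers everything
  since 0, so the equation is solved afresh on all of \<open>{0..S'}\<close> rather than restarted
  at \<open>S\<close>; uniqueness on \<open>{0..S}\<close> makes the new solution extend
  \<open>x\<close>.\<close>

lemma caputo_delay_solution_step:
  fixes f :: "real \<Rightarrow> 'a \<Rightarrow> 'a \<Rightarrow> 'a::euclidean_space"
  assumes "0 < \<alpha>" "0 < r" "0 \<le> S" "S \<le> S'" "S' \<le> S + r"
    and \<phi>: "continuous_on {-r..0} \<phi>"
    and f: "continuous_on ({0..S'} \<times> UNIV \<times> UNIV) (\<lambda>(t, x, y). f t x y)"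
    and L: "continuous_on ({0..S'} \<times> UNIV) (\<lambda>(t, y). L t y)"
    and Lip: "\<And>t x x' y. t \<in> {0..S'} \<Longrightarrow> norm (f t x y - f t x' y) \<le> L t y * norm (x - x')"
    and x: "caputo_delay_solution \<alpha> r S f \<phi> x"
    and x_unique: "\<And>z t. \<lbrakk>caputo_delay_solution \<alpha> r S f \<phi> z; t \<in> {-r..S}\<rbrakk> \<Longrightarrow> z t = x t"
  obtains x' where "caputo_delay_solution \<alpha> r S' f \<phi> x'"
    "\<And>z t. \<lbrakk>caputo_delay_solution \<alpha> r S' f \<phi> z; t \<in> {-r..S'}\<rbrakk> \<Longrightarrow> z t = x' t"
proof -
  define G where "G s u = f s u (x (s - r))" for s u
  have cont_delay: "continuous_on {0..S'} (\<lambda>s. x (s - r))"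
  proof (rule continuous_on_compose2[where g = x])
    show "continuous_on {-r..S} x"
      using x by (simp add: caputo_delay_solution_def)
  qed (use assms(5) in \<open>auto intro!: continuous_intros\<close>)
  have "continuous_on {0..S'} (\<lambda>s. L s (x (s - r)))"
    using L cont_delay by (rule continuous_on_apply_path) auto
  \<comment> \<open>Along the known delayed path \<open>L\<close> depends on time alone, so
    compactness yields one Lipschitz constant for \<open>G\<close>.\<close>
  then have "bounded ((\<lambda>s. L s (x (s - r))) ` {0..S'})"
    using compact_continuous_image compact_imp_bounded by blast
  then obtain M where M: "\<And>s. s \<in> {0..S'} \<Longrightarrow> \<bar>L s (x (s - r))\<bar> \<le> M"
    unfolding bounded_iff real_norm_def by blast
  have LipG: "norm (G t u - G t v) \<le> M * norm (u - v)" if "t \<in> {0..S'}" for t u v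
  proof -
    have "L t (x (t - r)) * norm (u - v) \<le> M * norm (u - v)"
      using M[OF that] by (intro mult_right_mono) auto
    then show ?thesis
      unfolding G_def using Lip[OF that] order_trans by blast
  qed
  have contG: "continuous_on ({0..S'} \<times> UNIV) (\<lambda>(t, u). G t u)"
  proof -
    have "continuous_on ({0..S'} \<times> UNIV) (\<lambda>p. x (fst p - r))"
      by (rule continuous_on_compose2[OF cont_delay]) (auto intro: continuous_intros)
    then have "continuous_on ({0..S'} \<times> UNIV)
        (\<lambda>p. (\<lambda>(t, x, y). f t x y) (fst p, snd p, x (fst p - r)))"
      by (intro continuous_on_compose2[OF f] continuous_intros) auto
    then show ?thesis
      by (simp add: G_def case_prod_beta)
  qed
  \<comment> \<open>Agreement with \<open>x\<close> up to \<open>S\<close> turns the delayed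
    equation into the undelayed one. This serves both \<open>x\<close> itself on
    \<open>{0..S}\<close> and a competitor on \<open>{0..S'}\<close>.\<close>
  have volterra: "z t = \<phi> 0 + frac_integral \<alpha> (\<lambda>s. G s (z s)) t"
    if "caputo_delay_solution \<alpha> r R f \<phi> z" "R \<le> S'" "t \<in> {0..R}"
      "\<And>s. s \<in> {-r..S} \<Longrightarrow> z s = x s" for z R t
  proof -
    have "frac_integral \<alpha> (\<lambda>s. f s (z s) (z (s - r))) t = frac_integral \<alpha> (\<lambda>s. G s (z s)) t"
      unfolding G_def using that(2-4) assms(5) by (intro frac_integral_cong) auto
    then show ?thesis
      using that(1,3) unfolding caputo_delay_solution_def by metis
  qed
  have "0 \<le> S'"
    using assms by simp
  obtain y where y: "continuous_on {0..S'} y"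
      "\<And>t. t \<in> {0..S'} \<Longrightarrow> y t = \<phi> 0 + frac_integral \<alpha> (\<lambda>s. G s (y s)) t"
    and y_unique: "\<And>z t. \<lbrakk>continuous_on {0..S'} z;
      \<And>t. t \<in> {0..S'} \<Longrightarrow> z t = \<phi> 0 + frac_integral \<alpha> (\<lambda>s. G s (z s)) t; t \<in> {0..S'}\<rbrakk> \<Longrightarrow> z t = y t"
    by (rule frac_volterra_unique_solution[OF \<open>0 < \<alpha>\<close> \<open>0 \<le> S'\<close> contG LipG]) blast+
  \<comment> \<open>Both functions solve the undelayed equation on \<open>{0..S}\<close>, so both
    equal its unique solution \<open>y'\<close> there.\<close>
  have y_eq_x: "y t = x t" if "t \<in> {0..S}" for t
  proof -
    have contGS: "continuous_on ({0..S} \<times> UNIV) (\<lambda>(t, u). G t u)"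
      using contG by (rule continuous_on_subset) (use assms(4) in auto)
    have LipGS: "norm (G t u - G t v) \<le> M * norm (u - v)" if "t \<in> {0..S}" for t u v
      using LipG that assms(4) by auto
    obtain y' where y': "\<And>z t. \<lbrakk>continuous_on {0..S} z;
      \<And>t. t \<in> {0..S} \<Longrightarrow> z t = \<phi> 0 + frac_integral \<alpha> (\<lambda>s. G s (z s)) t; t \<in> {0..S}\<rbrakk> \<Longrightarrow> z t = y' t"
      by (rule frac_volterra_unique_solution
          [OF \<open>0 < \<alpha>\<close> \<open>0 \<le> S\<close> contGS LipGS, where c = "\<phi> 0"]) (assumption, erule that)
    have "continuous_on {0..S} x"
      using caputo_delay_solution_continuous_on[OF x] by (rule continuous_on_subset) (use assms(2) in auto)
    then have "x t = y' t"
      by (rule y') (use volterra[OF x assms(4)] that in blast)+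
    moreover have "y t = y' t"
    proof (rule y')
      show "continuous_on {0..S} y"
        using y(1) by (rule continuous_on_subset) (use assms(4) in auto)
      show "y t = \<phi> 0 + frac_integral \<alpha> (\<lambda>s. G s (y s)) t" if "t \<in> {0..S}" for t
        using assms(4) that by (intro y(2)) auto
    qed (rule that)
    ultimately show ?thesis
      by simp
  qed
  define x' where "x' t = (if t \<le> 0 then \<phi> t else y t)" for t
  \<comment> \<open>The integral over \<open>{0..0}\<close> vanishes, so history and new solution
    match at the joint.\<close>
  have "y 0 = \<phi> 0"
    using y(2)[of 0] \<open>0 \<le> S'\<close> by (simp add: frac_integral_def)
  then have x'_eq_y: "x' t = y t" if "0 \<le> t" for t
    using that by (cases "t = 0") (auto simp: x'_def)
  have x'_eq_x: "x' t = x t" if "t \<in> {-r..S}" for t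
    using caputo_delay_solution_history[OF x, of t] y_eq_x[of t] that by (auto simp: x'_def)
  show thesis
  proof
    show "caputo_delay_solution \<alpha> r S' f \<phi> x'"
      unfolding caputo_delay_solution_def
    proof (intro conjI ballI)
      have "continuous_on ({-r..0} \<union> {0..S'}) (\<lambda>t. if t \<le> 0 then \<phi> t else y t)"
        using \<phi> y(1) \<open>y 0 = \<phi> 0\<close> by (intro continuous_on_If) auto
      moreover have "{-r..0} \<union> {0..S'} = {-r..S'}"
        using assms(2) \<open>0 \<le> S'\<close> by auto
      ultimately show "continuous_on {-r..S'} x'"
        by (simp add: x'_def[abs_def])
      show "x' t = \<phi> t" if "t \<in> {-r..0}" for t
        using that by (simp add: x'_def)
      show "x' t = \<phi> 0 + frac_integral \<alpha> (\<lambda>s. f s (x' s) (x' (s - r))) t" if "t \<in> {0..S'}" for t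
      proof -
        \<comment> \<open>The delayed argument \<open>s - r\<close> lies in \<open>{-r..S}\<close>,
          where \<open>x'\<close> is \<open>x\<close>; the current argument lies in
          \<open>{0..S'}\<close>, where \<open>x'\<close> is \<open>y\<close>.\<close>
        have "frac_integral \<alpha> (\<lambda>s. f s (x' s) (x' (s - r))) t = frac_integral \<alpha> (\<lambda>s. G s (y s)) t"
          using that assms(5) x'_eq_x x'_eq_y by (intro frac_integral_cong) (auto simp: G_def)
        then show ?thesis
          using y(2)[OF that] x'_eq_y[of t] that by (metis atLeastAtMost_iff)
      qed
    qed
    show "z t = x' t" if z: "caputo_delay_solution \<alpha> r S' f \<phi> z" and t: "t \<in> {-r..S'}" for z t
    proof -
      \<comment> \<open>Uniqueness up to \<open>S\<close> fixes the delayed values of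
        \<open>z\<close>, so \<open>z\<close> solves the same undelayed equation as
        \<open>y\<close>.\<close>
      have z_eq_x: "z s = x s" if "s \<in> {-r..S}" for s
        using x_unique caputo_delay_solution_subinterval[OF z assms(4)] that by blast
      have "continuous_on {0..S'} z"
        using caputo_delay_solution_continuous_on[OF z] by (rule continuous_on_subset) (use assms(2) in auto)
      then have "z t = y t" if "t \<in> {0..S'}" for t
        by (rule y_unique) (use volterra[OF z order_refl] z_eq_x that in blast)+
      then show ?thesis
        using caputo_delay_solution_history[OF z, of t] t by (cases "t \<le> 0") (auto simp: x'_def)
    qed
  qed
qed

section \<open>Iterated extension up to the final time\<close>

theorem theorem3p1:
  fixes \<alpha> r T :: real
    and N :: "real ^ 'd \<Rightarrow> real"
    and \<phi> :: "real \<Rightarrow> real ^ 'd"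
    and f :: "real \<Rightarrow> real ^ 'd \<Rightarrow> real ^ 'd \<Rightarrow> real ^ 'd"
  assumes "0 < \<alpha>" and "\<alpha> < 1" and "0 < r" and "0 < T"
    and "is_norm N"
    and "continuous_on {-r..0} \<phi>"
    and "continuous_on ({0..T} \<times> UNIV \<times> UNIV) (\<lambda>(t, x, y). f t x y)"
    and "\<exists>L :: real \<Rightarrow> real ^ 'd \<Rightarrow> real.
           continuous_on ({0..T} \<times> UNIV) (\<lambda>(t, y). L t y) \<and>
           (\<forall>t\<in>{0..T}. \<forall>y. 0 \<le> L t y) \<and>
           (\<forall>t\<in>{0..T}. \<forall>x x' y. N (f t x y - f t x' y) \<le> L t y * N (x - x'))"
  shows "\<exists>x. caputo_delay_solution \<alpha> r T f \<phi> x \<and>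
             (\<forall>z. caputo_delay_solution \<alpha> r T f \<phi> z \<longrightarrow> (\<forall>t\<in>{-r..T}. z t = x t))"
proof -
  obtain L where L: "continuous_on ({0..T} \<times> UNIV) (\<lambda>(t, y). L t y)"
    and L_nonneg: "\<And>t y. t \<in> {0..T} \<Longrightarrow> 0 \<le> L t y"
    and Lip: "\<And>t x x' y. t \<in> {0..T} \<Longrightarrow> N (f t x y - f t x' y) \<le> L t y * N (x - x')"
    using assms(8) by blast
  obtain B where B: "B > 0" "\<And>x. N x \<le> B * norm x"
    using is_norm_le_norm[OF assms(5)] by blast
  obtain C where C: "C > 0" "\<And>x. norm x \<le> C * N x"
    using norm_le_is_norm[OF assms(5)] by blast
  \<comment> \<open>The two norm-equivalence constants turn the condition in \<open>N\<close> into a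
    Euclidean one with \<open>C * B * L t y\<close> in place of \<open>L t y\<close>.\<close>
  have Lip': "norm (f t x y - f t x' y) \<le> (C * B * L t y) * norm (x - x')"
    if t: "t \<in> {0..T}" for t x x' y
  proof -
    have "norm (f t x y - f t x' y) \<le> C * (L t y * N (x - x'))"
      using C Lip[OF t] by (meson less_imp_le mult_left_mono order_trans)
    also have "\<dots> \<le> C * (L t y * (B * norm (x - x')))"
      using B(2) C(1) L_nonneg[OF t] by (intro mult_left_mono) auto
    finally show ?thesis
      by (simp add: mult_ac)
  qed
  have L': "continuous_on ({0..T} \<times> UNIV) (\<lambda>(t, y). C * B * L t y)"
    using continuous_on_mult[OF continuous_on_const L, of "C * B"]
    by (simp add: case_prod_beta)
  let ?P = "\<lambda>S. \<exists>x. caputo_delay_solution \<alpha> r S f \<phi> x \<and>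
             (\<forall>z. caputo_delay_solution \<alpha> r S f \<phi> z \<longrightarrow> (\<forall>t\<in>{-r..S}. z t = x t))"
  \<comment> \<open>The minimum stops the last step at \<open>T\<close>, beyond which nothing is
    assumed about \<open>f\<close>. Uniqueness is part of the induction claim because each step uses
    it on the previous interval.\<close>
  have P: "?P (min (real n * r) T)" for n
  proof (induction n)
    case 0
    \<comment> \<open>Up to time 0 the history is the solution: the integral equation is only
      required at 0, where the integral vanishes.\<close>
    have "caputo_delay_solution \<alpha> r 0 f \<phi> \<phi>"
      using assms(6) by (simp add: caputo_delay_solution_def frac_integral_def)
    moreover have "min (real 0 * r) T = 0"
      using assms(4) by simp
    ultimately show ?case
      using caputo_delay_solution_history by metis
  next
    case (Suc n)
    let ?S = "min (real n * r) T" and ?S' = "min (real (Suc n) * r) T"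
    obtain x where x: "caputo_delay_solution \<alpha> r ?S f \<phi> x"
      and x_unique: "\<And>z t. \<lbrakk>caputo_delay_solution \<alpha> r ?S f \<phi> z; t \<in> {-r..?S}\<rbrakk> \<Longrightarrow> z t = x t"
      using Suc.IH by blast
    have S: "0 \<le> ?S" "?S \<le> ?S'" "?S' \<le> ?S + r"
      using assms(3,4) by (auto simp: distrib_right min_def)
    have f': "continuous_on ({0..?S'} \<times> UNIV \<times> UNIV) (\<lambda>(t, x, y). f t x y)"
      using assms(7) by (rule continuous_on_subset) auto
    have L'': "continuous_on ({0..?S'} \<times> UNIV) (\<lambda>(t, y). C * B * L t y)"
      using L' by (rule continuous_on_subset) auto
    have Lip'': "norm (f t x y - f t x' y) \<le> (C * B * L t y) * norm (x - x')"
      if "t \<in> {0..?S'}" for t x x' y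
      using that by (intro Lip') auto
    show ?case
      by (rule caputo_delay_solution_step[OF assms(1,3) S assms(6) f' L'' _ x])
        (rule Lip'', assumption, rule x_unique, assumption+, blast)
  qed
  obtain n where "T < real n * r"
    using reals_Archimedean3[OF assms(3)] by blast
  then have n: "min (real n * r) T = T"
    by simp
  show ?thesis
    using P[of n] unfolding n .
qed

end
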